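(* Let $\mathcal{L}_1,\mathcal{L}_2\subseteq[0,1]^N$ be two loss spaces with $\mathcal{L}_1\subseteq\mathcal{A}_1$ and $\mathcal{L}_2\subseteq\mathcal{A}_2$, where $\mathcal{A}_1,\mathcal{A}_2\subseteq\mathbb{R}^N$ are centrally symmetric, convex, compact sets. Let $\boldsymbol{l}_1,\dots,\boldsymbol{l}_T$ be a sequence of loss vectors such that for each $t\in\{1,\dots,T\}$, $\boldsymbol{l}_t=\boldsymbol{l}_{1t}+\boldsymbol{l}_{2t}$ with $\boldsymbol{l}_{1t}\in\mathcal{L}_1$ and $\boldsymbol{l}_{2t}\in\mathcal{L}_2$ (the learner observes only $\boldsymbol{l}_t$). Let $R_1:\Omega_1\to\mathbb{R}$ and $R_2:\Omega_2\to\mathbb{R}$ be differentiable, strictly convex functions, where $\Omega_1,\Omega_2\supseteq\Delta_N$ are convex sets, and suppose the restrictions of $R_1$ and $R_2$ to $\Delta_N$ are, respectively, $\alpha_1$-strongly convex with respect to $\|\cdot\|^*_{\mathcal{A}_1}$ and $\alpha_2$-strongly convex with respect to $\|\cdot\|^*_{\mathcal{A}_2}$ ($\alpha_1,\alpha_2>0$). Let $\mathbf{p}_1:=\operatorname{argmin}_{\mathbf{p}\in\Delta_N}\left(R_1(\mathbf{p})+R_2(\mathbf{p})\right)$, and let $D_1,D_2$ be such that $R_1(\mathbf{p})-R_1(\mathbf{p}_1)\le D_1^2$ and $R_2(\mathbf{p})-R_2(\mathbf{p}_1)\le D_2^2$ for all $\mathbf{p}\in\Delta_N$. Then the Online Mirror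 Descent algorithm with regularizer $R:=R_1+R_2$ (on $\Omega=\Omega_1\cap\Omega_2$), initial prediction $\mathbf{p}_1$ and learning rate $\eta^*=\sqrt{\frac{(D_1^2+D_2^2)\min(\alpha_1,\alpha_2)}{T}}$ satisfies $$\mathrm{Regret}_T\le 2\sqrt{\frac{(D_1^2+D_2^2)\,T}{\min(\alpha_1,\alpha_2)}}.$$
   Context: Notation: $\Delta_N=\{\mathbf{x}\in[0,1]^N:\sum_i x_i=1\}$. For a convex, compact, centrally symmetric set $\mathcal{A}\subseteq\mathbb{R}^N$ ($\mathbf{a}\in\mathcal{A}\iff-\mathbf{a}\in\mathcal{A}$), the atomic norm is $\|\mathbf{x}\|_{\mathcal{A}}:=\inf\{t>0:\mathbf{x}\in t\mathcal{A}\}$ and its dual is the support function $\|\mathbf{x}\|^*_{\mathcal{A}}:=\sup\{\mathbf{x}\cdot\mathbf{z}:\mathbf{z}\in\mathcal{A}\}$. A differentiable $f$ is $\alpha$-strongly convex over a convex set $S$ with respect to $\|\cdot\|$ if $f(\mathbf{x})-f(\mathbf{y})-\nabla f(\mathbf{y})\cdot(\mathbf{x}-\mathbf{y})\ge\frac{\alpha}{2}\|\mathbf{x}-\mathbf{y}\|^2$ for all $\mathbf{x},\mathbf{y}\in S$. Prediction with expert advice: in each round $t=1,\dots,T$ the learner plays $\mathbf{p}_t\in\Delta_N$ (depending on $\boldsymbol{l}_1,\dots,\boldsymbol{l}_{t-1}$), then the loss vector $\boldsymbol{l}_t\in\mathbb{R}^N$ is revealed and the learner suffers $\mathbf{p}_t\cdot\boldsymbol{l}_t$.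 The regret is $\mathrm{Regret}_T=\sum_{t=1}^T\mathbf{p}_t\cdot\boldsymbol{l}_t-\min_{i\in\{1,\dots,N\}}\sum_{t=1}^T l_t(i)$. Online Mirror Descent (OMD) with learning rate $\eta>0$, convex set $\Omega\supseteq\Delta_N$ and strictly convex differentiable regularizer $R:\Omega\to\mathbb{R}$: start with $\mathbf{p}_1=\operatorname{argmin}_{\mathbf{p}\in\Delta_N}R(\mathbf{p})$; after observing $\boldsymbol{l}_t$, let $\tilde{\mathbf{p}}_{t+1}\in\Omega$ satisfy $\nabla R(\tilde{\mathbf{p}}_{t+1})=\nabla R(\mathbf{p}_t)-\eta\boldsymbol{l}_t$ (it is assumed that such a point of $\Omega$ exists), and set $\mathbf{p}_{t+1}=\operatorname{argmin}_{\mathbf{p}\in\Delta_N}B_R(\mathbf{p},\tilde{\mathbf{p}}_{t+1})$, where $B_R(\mathbf{u},\mathbf{v})=R(\mathbf{u})-R(\mathbf{v})-(\mathbf{u}-\mathbf{v})\cdot\nabla R(\mathbf{v})$ is the Bregman divergence. *)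

theory Defs
  imports "HOL-Analysis.Analysis"
begin

definition prob_simplex :: "(real ^ 'n) set" where
  "prob_simplex = {x. (\<forall>i. 0 \<le> x $ i \<and> x $ i \<le> 1) \<and> (\<Sum>i\<in>UNIV. x $ i) = 1}"

definition centrally_symmetric :: "'a::real_vector set \<Rightarrow> bool" where
  "centrally_symmetric A \<longleftrightarrow> (\<forall>a. a \<in> A \<longleftrightarrow> - a \<in> A)"

text \<open>The dual of the atomic norm of \<open>A\<close>, i.e. the support function of \<open>A\<close>. It is meaningful
  for nonempty bounded \<open>A\<close> only, since the supremum is taken in the reals.\<close>

definition dual_atomic_norm :: "'a::real_inner set \<Rightarrow> 'a \<Rightarrow> real" where
  "dual_atomic_norm A x = (SUP z\<in>A. x \<bullet> z)"

text \<open>\<open>G\<close> is a gradient field on \<open>S\<close> of the function \<open>f : S \<rightarrow> \<real>\<close>. The derivative is taken within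
  \<open>S\<close>, as \<open>f\<close> is a function on \<open>S\<close> and \<open>S\<close> need not be open. If \<open>S\<close> is convex with nonempty
  interior then \<open>G\<close> is unique on \<open>S\<close>; in general, for convex \<open>S\<close>, it is unique up to vectors
  orthogonal to all differences of points of \<open>S\<close>.\<close>

definition is_gradient_on :: "'a::real_inner set \<Rightarrow> ('a \<Rightarrow> real) \<Rightarrow> ('a \<Rightarrow> 'a) \<Rightarrow> bool" where
  "is_gradient_on S f G \<longleftrightarrow> (\<forall>x\<in>S. (f has_derivative (\<lambda>h. G x \<bullet> h)) (at x within S))"

definition strictly_convex_on :: "'a::real_vector set \<Rightarrow> ('a \<Rightarrow> real) \<Rightarrow> bool" where
  "strictly_convex_on S f \<longleftrightarrow> convex S \<and>
     (\<forall>x\<in>S. \<forall>y\<in>S. \<forall>u. x \<noteq> y \<and> 0 < u \<and> u < 1 \<longrightarrow>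
        f ((1 - u) *\<^sub>R x + u *\<^sub>R y) < (1 - u) * f x + u * f y)"

definition bregman :: "('a::real_inner \<Rightarrow> real) \<Rightarrow> ('a \<Rightarrow> 'a) \<Rightarrow> 'a \<Rightarrow> 'a \<Rightarrow> real" where
  "bregman R G u v = R u - R v - (u - v) \<bullet> G v"

text \<open>\<open>G\<close> is the gradient of \<open>f\<close>, and \<open>nrm\<close> the (semi)norm.\<close>

definition strongly_convex_on ::
    "'a::real_inner set \<Rightarrow> ('a \<Rightarrow> real) \<Rightarrow> real \<Rightarrow> ('a \<Rightarrow> real) \<Rightarrow> ('a \<Rightarrow> 'a) \<Rightarrow> bool" where
  "strongly_convex_on S nrm \<alpha> f G \<longleftrightarrow>
     (\<forall>x\<in>S. \<forall>y\<in>S. f x - f y - G y \<bullet> (x - y) \<ge> \<alpha> / 2 * (nrm (x - y))\<^sup>2)"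

text \<open>\<open>p 1, \<dots>, p T\<close> are the predictions of Online Mirror Descent on the losses \<open>l 1, \<dots>, l T\<close>, with
  regularizer \<open>R\<close> on \<open>\<Omega>\<close>, gradient \<open>G\<close> of \<open>R\<close> and learning rate \<open>\<eta>\<close>; \<open>q (t + 1)\<close> is the
  intermediate point before the projection to the simplex. The update after the last round \<open>T\<close>
  yields no further prediction and is left out.\<close>

definition omd_run :: "(real ^ 'n) set \<Rightarrow> (real ^ 'n \<Rightarrow> real) \<Rightarrow> (real ^ 'n \<Rightarrow> real ^ 'n) \<Rightarrow> real \<Rightarrow> nat \<Rightarrow>
    (nat \<Rightarrow> real ^ 'n) \<Rightarrow> (nat \<Rightarrow> real ^ 'n) \<Rightarrow> (nat \<Rightarrow> real ^ 'n) \<Rightarrow> bool" where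
  "omd_run \<Omega> R G \<eta> T l p q \<longleftrightarrow>
     is_arg_min R (\<lambda>x. x \<in> prob_simplex) (p 1) \<and>
     (\<forall>t\<in>{1..<T}.
        q (t + 1) \<in> \<Omega> \<and>
        G (q (t + 1)) = G (p t) - \<eta> *\<^sub>R l t \<and>
        is_arg_min (\<lambda>x. bregman R G x (q (t + 1))) (\<lambda>x. x \<in> prob_simplex) (p (t + 1)))"

definition regret :: "nat \<Rightarrow> (nat \<Rightarrow> real ^ 'n) \<Rightarrow> (nat \<Rightarrow> real ^ 'n) \<Rightarrow> real" where
  "regret T l p = (\<Sum>t=1..T. p t \<bullet> l t) - Min (range (\<lambda>i. \<Sum>t=1..T. l t $ i))"

end

theory Submission
  imports Defs
begin

text \<open>The first-order optimality of each projection turns a round of mirror descent into a telescoping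
  difference of Bregman divergences plus the stability term
  \<open>\<eta> l\<^sub>t \<bullet> (p\<^sub>t - p\<^sub>t\<^sub>+\<^sub>1) - B(p\<^sub>t\<^sub>+\<^sub>1, p\<^sub>t)\<close>. Splitting the loss, this term is at most
  \<open>\<Sum>\<^sub>j (\<eta> n\<^sub>j - \<alpha> n\<^sub>j\<^sup>2 / 2) \<le> \<eta>\<^sup>2 / \<alpha>\<close>, where \<open>n\<^sub>j\<close> is the \<open>j\<close>-th dual norm of \<open>p\<^sub>t\<^sub>+\<^sub>1 - p\<^sub>t\<close> and
  \<open>\<alpha> = min \<alpha>\<^sub>1 \<alpha>\<^sub>2\<close>. In the last round the comparator itself plays the role of \<open>p\<^sub>T\<^sub>+\<^sub>1\<close>.
  If \<open>D\<^sub>1 = D\<^sub>2 = 0\<close> the learning rate vanishes, but then strict convexity forces the simplex to be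
  a single point.\<close>

section \<open>Directional derivatives within convex sets and first-order optimality\<close>

lemma strictly_convex_onD:
  assumes "strictly_convex_on S f" "x \<in> S" "y \<in> S" "x \<noteq> y" "0 < u" "u < 1"
  shows "f ((1 - u) *\<^sub>R x + u *\<^sub>R y) < (1 - u) * f x + u * f y"
  using assms by (simp add: strictly_convex_on_def)

text \<open>Convexity keeps the segment from \<open>x\<close> to \<open>y\<close> inside
  \<open>S\<close>, so the chain rule applies to \<open>f\<close> along it. The derivative of this
  one-variable function at 0 within \<open>{0..1}\<close> is the one-sided limit.\<close>

lemma has_derivative_imp_directional_limit:
  fixes f :: "'a::real_normed_vector \<Rightarrow> real"
  assumes "(f has_derivative f') (at x within S)" "convex S" "x \<in> S" "y \<in> S"
  shows "((\<lambda>s. (f (x + s *\<^sub>R (y - x)) - f x) / s) \<longlongrightarrow> f' (y - x)) (at_right 0)"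
proof -
  have sub: "(\<lambda>s. x + s *\<^sub>R (y - x)) ` {0..1::real} \<subseteq> S"
  proof clarify
    fix s :: real assume "s \<in> {0..1}"
    then have "(1 - s) *\<^sub>R x + s *\<^sub>R y \<in> S"
      using assms(2-4) by (intro convexD) auto
    then show "x + s *\<^sub>R (y - x) \<in> S" by (simp add: algebra_simps)
  qed
  have 1: "((\<lambda>s. x + s *\<^sub>R (y - x)) has_derivative (\<lambda>s. s *\<^sub>R (y - x))) (at 0 within {0..1::real})"
    by (auto intro!: derivative_eq_intros)
  have 2: "(f has_derivative f') (at (x + 0 *\<^sub>R (y - x)) within (\<lambda>s. x + s *\<^sub>R (y - x)) ` {0..1::real})"
    using has_derivative_subset[OF assms(1) sub] by simp
  have lin: "linear f'" using assms(1) has_derivative_linear by blast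
  have "((\<lambda>s. f (x + s *\<^sub>R (y - x))) has_derivative (\<lambda>s. f' (s *\<^sub>R (y - x)))) (at 0 within {0..1})"
    using diff_chain_within[OF 1 2] by (simp add: o_def)
  moreover have "(\<lambda>s. f' (s *\<^sub>R (y - x))) = (*) (f' (y - x))"
    using linear_cmul[OF lin] by (simp add: fun_eq_iff mult.commute)
  ultimately have "((\<lambda>s. f (x + s *\<^sub>R (y - x))) has_field_derivative f' (y - x)) (at 0 within {0..1})"
    by (simp add: has_field_derivative_def)
  then show ?thesis
    by (simp add: has_field_derivative_iff at_within_Icc_at_right)
qed

text \<open>A convex set with empty interior does not determine the derivative within it, but both
  candidates are the limit of the same difference quotients towards \<open>y\<close>. This later
  allows comparing \<open>G\<close> with \<open>G1\<close> and \<open>G2\<close>.\<close>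

lemma directional_derivative_unique:
  fixes f :: "'a::real_normed_vector \<Rightarrow> real"
  assumes "(f has_derivative f') (at x within S)" "(f has_derivative f'') (at x within S)"
    and "convex S" "x \<in> S" "y \<in> S"
  shows "f' (y - x) = f'' (y - x)"
  using tendsto_unique[OF _ has_derivative_imp_directional_limit[OF assms(1,3-5)]
      has_derivative_imp_directional_limit[OF assms(2-5)]]
  by simp

text \<open>The segment from the minimizer \<open>x\<close> to \<open>y\<close> stays in
  \<open>K\<close>, so all difference quotients along it are nonnegative, and so is their
  limit.\<close>

lemma is_arg_min_directional_derivative_nonneg:
  fixes f :: "'a::real_normed_vector \<Rightarrow> real"
  assumes "is_arg_min f (\<lambda>x. x \<in> K) x" "(f has_derivative f') (at x within S)"
    and "convex K" "K \<subseteq> S" "y \<in> K"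
  shows "0 \<le> f' (y - x)"
proof (rule tendsto_lowerbound)
  have x: "x \<in> K" and min: "\<And>z. z \<in> K \<Longrightarrow> f x \<le> f z"
    using assms(1) by (auto simp: is_arg_min_def not_less)
  show "((\<lambda>s. (f (x + s *\<^sub>R (y - x)) - f x) / s) \<longlongrightarrow> f' (y - x)) (at_right 0)"
    using has_derivative_subset[OF assms(2,4)] assms(3,5) x
    by (intro has_derivative_imp_directional_limit)
  have "0 \<le> (f (x + s *\<^sub>R (y - x)) - f x) / s" if "0 < s" "s < 1" for s :: real
  proof -
    have "(1 - s) *\<^sub>R x + s *\<^sub>R y \<in> K"
      using that assms(3,5) x by (intro convexD) auto
    then have "f x \<le> f (x + s *\<^sub>R (y - x))" by (intro min) (simp add: algebra_simps)
    with that show ?thesis by simp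
  qed
  then show "\<forall>\<^sub>F s in at_right 0. 0 \<le> (f (x + s *\<^sub>R (y - x)) - f x) / s"
    by (auto simp: eventually_at_right_field intro!: exI[of _ 1])
qed simp

text \<open>In its first argument the divergence differs from \<open>R\<close> by an affine
  function, so \<open>G p - G q\<close> is a gradient of it at \<open>p\<close>.\<close>

lemma bregman_arg_min_optimality:
  assumes "is_gradient_on \<Omega> R G" "convex K" "K \<subseteq> \<Omega>"
    and "is_arg_min (\<lambda>x. bregman R G x q) (\<lambda>x. x \<in> K) p" "u \<in> K"
  shows "0 \<le> (G p - G q) \<bullet> (u - p)"
proof -
  have "p \<in> \<Omega>" using assms(3,4) by (auto simp: is_arg_min_def)
  then have "(R has_derivative (\<lambda>h. G p \<bullet> h)) (at p within \<Omega>)"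
    using assms(1) by (simp add: is_gradient_on_def)
  then have "((\<lambda>x. bregman R G x q) has_derivative (\<lambda>h. (G p - G q) \<bullet> h)) (at p within \<Omega>)"
    unfolding bregman_def
    by (auto intro!: derivative_eq_intros simp: inner_diff_right inner_commute)
  from is_arg_min_directional_derivative_nonneg[OF assms(4) this assms(2,3,5)] show ?thesis .
qed

section \<open>Bregman divergences and the regret of mirror descent\<close>

lemma bregman_three_point:
  "bregman R G u x - bregman R G u y - bregman R G y x = (G y - G x) \<bullet> (u - y)"
  by (simp add: bregman_def algebra_simps inner_commute)

text \<open>The assumption \<open>stable\<close> ranges over all \<open>x\<close> in
  \<open>K\<close>, not just the next iterate: the last round uses it with \<open>x\<close> the
  comparator \<open>u\<close>.\<close>

lemma mirror_descent_regret:
  assumes grad: "is_gradient_on \<Omega> R G" and K: "convex K" "K \<subseteq> \<Omega>"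
    and p: "\<And>t. t \<in> {1..T} \<Longrightarrow> p t \<in> K"
    and q: "\<And>t. t \<in> {1..<T} \<Longrightarrow> G (q (t + 1)) = G (p t) - \<eta> *\<^sub>R l t"
    and proj: "\<And>t. t \<in> {1..<T} \<Longrightarrow>
      is_arg_min (\<lambda>x. bregman R G x (q (t + 1))) (\<lambda>x. x \<in> K) (p (t + 1))"
    and stable: "\<And>t x y. t \<in> {1..T} \<Longrightarrow> x \<in> K \<Longrightarrow> y \<in> K \<Longrightarrow>
      \<eta> * (l t \<bullet> (y - x)) - bregman R G x y \<le> c"
    and "T \<ge> 1" "u \<in> K"
  shows "\<eta> * (\<Sum>t=1..T. l t \<bullet> (p t - u)) \<le> bregman R G u (p 1) + real T * c"
proof -
  have step: "\<eta> * (l t \<bullet> (p t - u)) \<le> bregman R G u (p t) - bregman R G u (p (t + 1)) + c"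
    if t: "t \<in> {1..<T}" for t
  proof -
    have "0 \<le> (G (p (t + 1)) - G (q (t + 1))) \<bullet> (u - p (t + 1))"
      using bregman_arg_min_optimality[OF grad K proj[OF t] \<open>u \<in> K\<close>] .
    then have "\<eta> * (l t \<bullet> (p (t + 1) - u)) \<le> (G (p (t + 1)) - G (p t)) \<bullet> (u - p (t + 1))"
      unfolding q[OF t] by (simp add: algebra_simps)
    also have "\<dots> = bregman R G u (p t) - bregman R G u (p (t + 1)) - bregman R G (p (t + 1)) (p t)"
      by (simp only: bregman_three_point)
    finally have "\<eta> * (l t \<bullet> (p (t + 1) - u)) \<le> \<dots>" .
    \<comment> \<open>The loss against \<open>u\<close> is split at \<open>p (t + 1)\<close>. The
      negative divergence left over from the three-point identity pays for the movement from
      \<open>p t\<close> to \<open>p (t + 1)\<close>.\<close>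
    moreover have "\<eta> * (l t \<bullet> (p t - p (t + 1))) - bregman R G (p (t + 1)) (p t) \<le> c"
      using t by (intro stable p) auto
    ultimately show ?thesis by (simp add: inner_diff_right right_diff_distrib)
  qed
  \<comment> \<open>Only \<open>n < T\<close> is possible, as no projection follows round
    \<open>T\<close>. The divergence at \<open>p (n + 1)\<close> is kept because, for
    \<open>n = T - 1\<close>, it absorbs the one from the last round.\<close>
  have "\<eta> * (\<Sum>t=1..n. l t \<bullet> (p t - u))
      \<le> bregman R G u (p 1) - bregman R G u (p (n + 1)) + real n * c" if "n < T" for n
    using that
  proof (induction n)
    case (Suc n)
    then show ?case using step[of "Suc n"] by (simp add: algebra_simps)
  qed simp
  from this[of "T - 1"] \<open>T \<ge> 1\<close>
  have "\<eta> * (\<Sum>t=1..T-1. l t \<bullet> (p t - u))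
      \<le> bregman R G u (p 1) - bregman R G u (p T) + (real T - 1) * c"
    by (simp add: of_nat_diff)
  moreover have "\<eta> * (l T \<bullet> (p T - u)) - bregman R G u (p T) \<le> c"
    using \<open>T \<ge> 1\<close> \<open>u \<in> K\<close> by (intro stable p) auto
  moreover have "(\<Sum>t=1..T. l t \<bullet> (p t - u)) = (\<Sum>t=1..T-1. l t \<bullet> (p t - u)) + l T \<bullet> (p T - u)"
    using \<open>T \<ge> 1\<close> by (cases T) auto
  ultimately show ?thesis by (simp only: distrib_left left_diff_distrib mult_1)
qed

section \<open>Dual norms and the scalar quadratic bound\<close>

lemma inner_le_dual_atomic_norm:
  assumes "bounded A" "z \<in> A"
  shows "x \<bullet> z \<le> dual_atomic_norm A x"
proof -
  have "bdd_above ((\<lambda>z. x \<bullet> z) ` A)"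
    using bounded_linear_image[OF assms(1) bounded_linear_inner_right]
    by (rule bounded_imp_bdd_above)
  then show ?thesis
    unfolding dual_atomic_norm_def using assms(2) by (rule cSUP_upper2) simp
qed

text \<open>Central symmetry allows \<open>- z\<close> as a competitor in the supremum. The reversed
  difference on the right is the one occurring in the strong convexity bound for the divergence of
  \<open>x\<close> from \<open>y\<close>.\<close>

lemma inner_diff_le_dual_atomic_norm:
  assumes "bounded A" "centrally_symmetric A" "z \<in> A"
  shows "z \<bullet> (y - x) \<le> dual_atomic_norm A (x - y)"
proof -
  have "- z \<in> A" using assms(2,3) by (simp add: centrally_symmetric_def)
  from inner_le_dual_atomic_norm[OF assms(1) this, of "x - y"] show ?thesis
    by (simp add: algebra_simps inner_commute)
qed

text \<open>Completing the square; the maximum over \<open>n\<close> is attained at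
  \<open>n = \<eta> / a\<close>.\<close>

lemma linear_minus_quadratic_le:
  fixes a n \<eta> :: real
  assumes "a > 0"
  shows "\<eta> * n - a / 2 * n\<^sup>2 \<le> \<eta>\<^sup>2 / (2 * a)"
proof -
  have "\<eta>\<^sup>2 / (2 * a) - (\<eta> * n - a / 2 * n\<^sup>2) = (\<eta> - a * n)\<^sup>2 / (2 * a)"
    using assms by (simp add: field_simps power2_eq_square)
  also have "\<dots> \<ge> 0" using assms by simp
  finally show ?thesis by simp
qed

section \<open>The simplex and its points as comparators\<close>

lemma convex_prob_simplex: "convex (prob_simplex :: (real ^ 'n) set)"
proof (rule convexI)
  fix x y :: "real ^ 'n" and a b :: real
  assume xy: "x \<in> prob_simplex" "y \<in> prob_simplex" and ab: "0 \<le> a" "0 \<le> b" "a + b = 1"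
  have "a * x $ i + b * y $ i \<le> 1" for i
    using xy ab by (intro convex_bound_le) (auto simp: prob_simplex_def)
  then show "a *\<^sub>R x + b *\<^sub>R y \<in> prob_simplex"
    using xy ab by (simp add: prob_simplex_def sum.distrib flip: sum_distrib_left)
qed

lemma axis_mem_prob_simplex: "axis i 1 \<in> prob_simplex"
  by (simp add: prob_simplex_def axis_def)

text \<open>The best expert is itself a comparator, namely the vertex \<open>axis i 1\<close> of the
  simplex.\<close>

lemma regret_leI:
  assumes "\<And>u. u \<in> prob_simplex \<Longrightarrow> (\<Sum>t=1..T. l t \<bullet> (p t - u)) \<le> b"
  shows "regret T l p \<le> b"
proof -
  have "Min (range (\<lambda>i. \<Sum>t=1..T. l t $ i)) \<in> range (\<lambda>i. \<Sum>t=1..T. l t $ i)"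
    by (intro Min_in) auto
  then obtain i where "Min (range (\<lambda>i. \<Sum>t=1..T. l t $ i)) = (\<Sum>t=1..T. l t $ i)" by blast
  then have "regret T l p = (\<Sum>t=1..T. l t \<bullet> (p t - axis i 1))"
    by (simp add: regret_def inner_diff_right sum_subtractf inner_axis inner_commute[of "p _"])
  with assms[OF axis_mem_prob_simplex] show ?thesis by simp
qed

theorem theorem4:
  fixes L1 L2 A1 A2 \<Omega>1 \<Omega>2 :: "(real ^ 'n) set"
    and R1 R2 :: "real ^ 'n \<Rightarrow> real"
    and G1 G2 G :: "real ^ 'n \<Rightarrow> real ^ 'n"
    and l l1 l2 p q :: "nat \<Rightarrow> real ^ 'n"
    and \<alpha>1 \<alpha>2 D1 D2 :: real
    and T :: nat
  assumes "L1 \<subseteq> {x. \<forall>i. 0 \<le> x $ i \<and> x $ i \<le> 1}"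
    and "L2 \<subseteq> {x. \<forall>i. 0 \<le> x $ i \<and> x $ i \<le> 1}"
    and "L1 \<subseteq> A1" and "L2 \<subseteq> A2"
    and "centrally_symmetric A1" and "convex A1" and "compact A1"
    and "centrally_symmetric A2" and "convex A2" and "compact A2"
    and "T \<ge> 1"
    and "\<And>t. t \<in> {1..T} \<Longrightarrow> l t = l1 t + l2 t"
    and "\<And>t. t \<in> {1..T} \<Longrightarrow> l1 t \<in> L1"
    and "\<And>t. t \<in> {1..T} \<Longrightarrow> l2 t \<in> L2"
    and "convex \<Omega>1" and "prob_simplex \<subseteq> \<Omega>1"
    and "convex \<Omega>2" and "prob_simplex \<subseteq> \<Omega>2"
    and "is_gradient_on \<Omega>1 R1 G1" and "strictly_convex_on \<Omega>1 R1"
    and "is_gradient_on \<Omega>2 R2 G2" and "strictly_convex_on \<Omega>2 R2"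
    and "\<alpha>1 > 0" and "\<alpha>2 > 0"
    and "strongly_convex_on prob_simplex (dual_atomic_norm A1) \<alpha>1 R1 G1"
    and "strongly_convex_on prob_simplex (dual_atomic_norm A2) \<alpha>2 R2 G2"
    and "is_gradient_on (\<Omega>1 \<inter> \<Omega>2) (\<lambda>x. R1 x + R2 x) G"
    and "omd_run (\<Omega>1 \<inter> \<Omega>2) (\<lambda>x. R1 x + R2 x) G
           (sqrt ((D1\<^sup>2 + D2\<^sup>2) * min \<alpha>1 \<alpha>2 / real T)) T l p q"
    and "\<And>x. x \<in> prob_simplex \<Longrightarrow> R1 x - R1 (p 1) \<le> D1\<^sup>2"
    and "\<And>x. x \<in> prob_simplex \<Longrightarrow> R2 x - R2 (p 1) \<le> D2\<^sup>2"
  shows "regret T l p \<le> 2 * sqrt ((D1\<^sup>2 + D2\<^sup>2) * real T / min \<alpha>1 \<alpha>2)"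
proof -
  note inc = assms(3,4) and sym = assms(5,8) and cpt = assms(7,10)
    and T = \<open>T \<ge> 1\<close> and l = assms(12-14) and sub = assms(16,18)
    and scvx = assms(20,22) and \<alpha> = \<open>\<alpha>1 > 0\<close> \<open>\<alpha>2 > 0\<close> and strong = assms(25,26)
    and grad = assms(27) and run = assms(28) and D = assms(29,30)
  define R where "R = (\<lambda>x. R1 x + R2 x)"
  define \<alpha> where "\<alpha> = min \<alpha>1 \<alpha>2"
  define E where "E = D1\<^sup>2 + D2\<^sup>2"
  define \<eta> where "\<eta> = sqrt (E * \<alpha> / real T)"
  let ?K = "prob_simplex :: (real ^ 'n) set"
  have \<alpha>_pos: "\<alpha> > 0" using \<alpha> by (simp add: \<alpha>_def)
  have K: "convex ?K" "?K \<subseteq> \<Omega>1 \<inter> \<Omega>2" using convex_prob_simplex sub by auto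
  have gradR: "is_gradient_on (\<Omega>1 \<inter> \<Omega>2) R G" using grad by (simp add: R_def)
  have p1: "is_arg_min R (\<lambda>x. x \<in> ?K) (p 1)"
    and step: "\<And>t. t \<in> {1..<T} \<Longrightarrow> G (q (t + 1)) = G (p t) - \<eta> *\<^sub>R l t"
      "\<And>t. t \<in> {1..<T} \<Longrightarrow>
        is_arg_min (\<lambda>x. bregman R G x (q (t + 1))) (\<lambda>x. x \<in> ?K) (p (t + 1))"
    using run unfolding omd_run_def R_def \<eta>_def E_def \<alpha>_def by auto
  have p: "p t \<in> ?K" if "t \<in> {1..T}" for t
  proof (cases "t = 1")
    case True
    then show ?thesis using p1 by (simp add: is_arg_min_def)
  next
    case False
    then have "t - 1 \<in> {1..<T}" "t - 1 + 1 = t" using that by auto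
    with step(2)[of "t - 1"] show ?thesis by (simp add: is_arg_min_def)
  qed
  show ?thesis
  proof (cases "E = 0")
    case True
    then have D0: "D1 = 0" "D2 = 0" by (auto simp: E_def sum_power2_eq_zero_iff)
    \<comment> \<open>With \<open>D1 = D2 = 0\<close> neither \<open>R1\<close> nor
      \<open>R2\<close> is larger at \<open>x\<close> than at \<open>p 1\<close>, so by strict
      convexity the midpoint of two distinct points would beat the minimizer \<open>p 1\<close> of
      \<open>R\<close>.\<close>
    have single: "x = p 1" if x: "x \<in> ?K" for x
    proof (rule ccontr)
      assume ne: "x \<noteq> p 1"
      let ?m = "(1 - 1/2) *\<^sub>R p 1 + (1/2) *\<^sub>R x"
      have p1K: "p 1 \<in> ?K" using p T by simp
      then have "?m \<in> ?K" using x K(1) by (intro convexD) auto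
      then have "R (p 1) \<le> R ?m" using p1 by (auto simp: is_arg_min_def not_less)
      moreover have "R1 ?m < (1 - 1/2) * R1 (p 1) + 1/2 * R1 x"
        "R2 ?m < (1 - 1/2) * R2 (p 1) + 1/2 * R2 x"
        using ne x p1K sub
        by (intro strictly_convex_onD[OF scvx(1)] strictly_convex_onD[OF scvx(2)]; auto)+
      moreover have "R1 x \<le> R1 (p 1)" "R2 x \<le> R2 (p 1)" using D[OF x] D0 by auto
      ultimately show False by (simp add: R_def)
    qed
    have "p t - u = 0" if "t \<in> {1..T}" "u \<in> ?K" for t u
      using single[OF p[OF that(1)]] single[OF that(2)] by simp
    then have "regret T l p \<le> 0" by (intro regret_leI) simp
    then show ?thesis using D0 by simp
  next
    case False
    then have "E > 0" by (simp add: E_def order_less_le)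
    then have \<eta>: "\<eta> > 0" "\<eta>\<^sup>2 = E * \<alpha> / real T" using \<alpha>_pos T by (auto simp: \<eta>_def)
    \<comment> \<open>\<open>G\<close> is an arbitrary gradient field of the sum on the intersection
      and may differ from the sum of \<open>G1\<close> and \<open>G2\<close>; they agree on
      differences of points, which is all the divergence sees.\<close>
    have grad_split: "G y \<bullet> (x - y) = G1 y \<bullet> (x - y) + G2 y \<bullet> (x - y)"
      if "x \<in> ?K" "y \<in> ?K" for x y
    proof -
      have xy: "x \<in> \<Omega>1 \<inter> \<Omega>2" "y \<in> \<Omega>1 \<inter> \<Omega>2" using that K(2) by auto
      have "(R1 has_derivative (\<lambda>h. G1 y \<bullet> h)) (at y within \<Omega>1 \<inter> \<Omega>2)"
        "(R2 has_derivative (\<lambda>h. G2 y \<bullet> h)) (at y within \<Omega>1 \<inter> \<Omega>2)"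
        using assms(19,21) xy unfolding is_gradient_on_def
        by (auto intro: has_derivative_subset)
      then have "(R has_derivative (\<lambda>h. G1 y \<bullet> h + G2 y \<bullet> h)) (at y within \<Omega>1 \<inter> \<Omega>2)"
        unfolding R_def by (rule has_derivative_add)
      moreover have "(R has_derivative (\<lambda>h. G y \<bullet> h)) (at y within \<Omega>1 \<inter> \<Omega>2)"
        using gradR xy by (simp add: is_gradient_on_def)
      moreover have "convex (\<Omega>1 \<inter> \<Omega>2)" using assms(15,17) by (rule convex_Int)
      ultimately show ?thesis using xy by (intro directional_derivative_unique)
    qed
    have stable: "\<eta> * (l t \<bullet> (y - x)) - bregman R G x y \<le> \<eta>\<^sup>2 / \<alpha>"
      if t: "t \<in> {1..T}" and xy: "x \<in> ?K" "y \<in> ?K" for t x y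
    proof -
      define n1 n2 where "n1 = dual_atomic_norm A1 (x - y)" and "n2 = dual_atomic_norm A2 (x - y)"
      have "l1 t \<bullet> (y - x) \<le> n1" "l2 t \<bullet> (y - x) \<le> n2"
        unfolding n1_def n2_def
        using cpt sym l(2,3)[OF t] inc
        by (auto intro!: inner_diff_le_dual_atomic_norm compact_imp_bounded)
      then have "l t \<bullet> (y - x) \<le> n1 + n2" by (simp add: l(1)[OF t] inner_add_left)
      then have "\<eta> * (l t \<bullet> (y - x)) \<le> \<eta> * n1 + \<eta> * n2"
        using \<eta>(1) by (simp flip: distrib_left)
      \<comment> \<open>The divergence of the sum is the sum of the two divergences, and each
        controls its own norm; so the learner need not know how the loss splits.\<close>
      moreover have "\<alpha> / 2 * n1\<^sup>2 + \<alpha> / 2 * n2\<^sup>2 \<le> bregman R G x y"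
      proof -
        have "\<alpha> / 2 * n1\<^sup>2 \<le> \<alpha>1 / 2 * n1\<^sup>2" "\<alpha> / 2 * n2\<^sup>2 \<le> \<alpha>2 / 2 * n2\<^sup>2"
          by (intro mult_right_mono; simp add: \<alpha>_def)+
        moreover have "\<alpha>1 / 2 * n1\<^sup>2 \<le> R1 x - R1 y - G1 y \<bullet> (x - y)"
          "\<alpha>2 / 2 * n2\<^sup>2 \<le> R2 x - R2 y - G2 y \<bullet> (x - y)"
          using strong xy unfolding strongly_convex_on_def n1_def n2_def by auto
        ultimately show ?thesis
          using grad_split[OF xy] by (simp add: bregman_def R_def inner_commute)
      qed
      moreover have "\<eta> * n1 - \<alpha> / 2 * n1\<^sup>2 \<le> \<eta>\<^sup>2 / (2 * \<alpha>)" "\<eta> * n2 - \<alpha> / 2 * n2\<^sup>2 \<le> \<eta>\<^sup>2 / (2 * \<alpha>)"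
        using \<alpha>_pos by (simp_all only: linear_minus_quadratic_le)
      moreover have "\<eta>\<^sup>2 / (2 * \<alpha>) + \<eta>\<^sup>2 / (2 * \<alpha>) = \<eta>\<^sup>2 / \<alpha>" by simp
      ultimately show ?thesis by linarith
    qed
    show ?thesis
    proof (rule regret_leI)
      fix u assume u: "u \<in> ?K"
      have "(R has_derivative (\<lambda>h. G (p 1) \<bullet> h)) (at (p 1) within \<Omega>1 \<inter> \<Omega>2)"
        using gradR p[of 1] T K(2) by (auto simp: is_gradient_on_def)
      from is_arg_min_directional_derivative_nonneg[OF p1 this K u]
      have "bregman R G u (p 1) \<le> E"
        using D[OF u] by (simp add: bregman_def R_def E_def inner_commute)
      moreover have "\<eta> * (\<Sum>t=1..T. l t \<bullet> (p t - u)) \<le> bregman R G u (p 1) + real T * (\<eta>\<^sup>2 / \<alpha>)"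
        by (rule mirror_descent_regret[where p = p and q = q and l = l, OF gradR K])
          (use p step stable T u in auto)
      ultimately have "\<eta> * (\<Sum>t=1..T. l t \<bullet> (p t - u)) \<le> E + real T * (\<eta>\<^sup>2 / \<alpha>)" by simp
      \<comment> \<open>The learning rate balances the two terms:
        \<open>real T * (\<eta>\<^sup>2 / \<alpha>)\<close> equals \<open>E\<close>.\<close>
      also have "\<dots> = 2 * E" using \<eta>(2) \<alpha>_pos T by simp
      also have "\<dots> = \<eta> * (2 * sqrt (E * real T / \<alpha>))"
      proof -
        \<comment> \<open>Under the product of the roots \<open>T\<close> and
          \<open>\<alpha>\<close> cancel. Factoring out \<open>\<eta>\<close> in this way prepares
          the final division by it.\<close>
        have "\<eta> * sqrt (E * real T / \<alpha>) = sqrt (E\<^sup>2)"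
          unfolding \<eta>_def real_sqrt_mult[symmetric]
          using \<alpha>_pos T by (simp add: power2_eq_square)
        then show ?thesis using \<open>E > 0\<close> by simp
      qed
      finally show "(\<Sum>t=1..T. l t \<bullet> (p t - u)) \<le> 2 * sqrt ((D1\<^sup>2 + D2\<^sup>2) * real T / min \<alpha>1 \<alpha>2)"
        using \<eta>(1) unfolding E_def \<alpha>_def by simp
    qed
  qed
qed

end
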